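(* Let $k\geq1$, $s_0\in\mathbb{C}$, $\epsilon\in\{\pm1\}$. Assume $f,g:\mathbb{R}^k\setminus\{0\}\to\mathbb{C}$ are both $C^\infty$ and homogeneous of type $(1,1)$ and $(s_0,\epsilon)$ respectively. Assume furthermore that $f(x)$ is a positive real number for all $0\neq x\in\mathbb{R}^k$. Then for every $z\in\mathbb{T}^k$ with $z\neq(1,\dots,1)$, the series $\sum_{0\neq n\in\mathbb{Z}^k}f(n)^{-s}g(n)z^n$ is t-summable for all $s\in\mathbb{C}$ and its sum is a holomorphic function of $s\in\mathbb{C}$.
   Context: $\mathbb{T}=\{z\in\mathbb{C}:|z|=1\}$ and $z^n=z_1^{n_1}\cdots z_k^{n_k}$. Homogeneity: $f:\mathbb{R}^k\setminus\{0\}\to\mathbb{C}$ is homogeneous of type $(\sigma,\epsilon)\in\mathbb{C}\times\{\pm1\}$ if $f(tx)=t^{\sigma}f(x)$ and $f(-x)=\epsilon f(x)$ for all $t>0$, $x\ne0$. t-summability: for $c:\mathbb{Z}^k\to\mathbb{C}$ finitely supported and $a:\mathbb{Z}^k\to\mathbb{C}$, $(c*a)(n)=\sum_{m}c(m)a(n-m)$. The series $\sum_na(n)$ is t-summable if there is a finitely supported $c$ with $\sum c\neq0$ and $\sum_n|(c*a)(n)|<\infty$; its sum is then $(\sum c)^{-1}\sum_n(c*a)(n)$, independent of $c$. A series indexed by a subset of $\mathbb{Z}^k$ is extended by zero. *)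

theory Defs
  imports "HOL-Complex_Analysis.Complex_Analysis"
begin

section \<open>Smooth and homogeneous functions\<close>

text \<open>For open sets \<open>S\<close> only: all derivatives are taken with respect to full neighbourhoods.\<close>

primrec Ck_on :: "nat \<Rightarrow> ('a::real_normed_vector \<Rightarrow> 'b::real_normed_vector) \<Rightarrow> 'a set \<Rightarrow> bool" where
  "Ck_on 0 f S \<longleftrightarrow> continuous_on S f"
| "Ck_on (Suc r) f S \<longleftrightarrow>
     (\<forall>x\<in>S. f differentiable (at x)) \<and> (\<forall>v. Ck_on r (\<lambda>x. frechet_derivative f (at x) v) S)"

definition smooth_on :: "('a::real_normed_vector \<Rightarrow> 'b::real_normed_vector) \<Rightarrow> 'a set \<Rightarrow> bool" where
  "smooth_on f S \<longleftrightarrow> (\<forall>r. Ck_on r f S)"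

text \<open>Functions on the punctured space are defined on the whole space; the value at \<open>0\<close> is irrelevant.\<close>

definition homogeneous :: "complex \<Rightarrow> int \<Rightarrow> ('a::real_vector \<Rightarrow> complex) \<Rightarrow> bool" where
  "homogeneous \<sigma> \<epsilon> f \<longleftrightarrow>
     (\<forall>t::real. \<forall>x. t > 0 \<longrightarrow> x \<noteq> 0 \<longrightarrow> f (t *\<^sub>R x) = complex_of_real t powr \<sigma> * f x) \<and>
     (\<forall>x. x \<noteq> 0 \<longrightarrow> f (- x) = of_int \<epsilon> * f x)"

section \<open>Lattice points and characters of the torus\<close>

definition lattice_vec :: "int ^ 'k \<Rightarrow> real ^ 'k" where
  "lattice_vec n = (\<chi> i. of_int (n $ i))"

definition monom_powi :: "complex ^ 'k \<Rightarrow> int ^ 'k \<Rightarrow> complex" where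
  "monom_powi z n = (\<Prod>i\<in>UNIV. (z $ i) powi (n $ i))"

text \<open>The terms of the series; the values \<open>f n\<close> are positive reals wherever this is used, so
  \<open>powr\<close> is the unambiguous power \<open>exp (- s * ln (f n))\<close>.\<close>

definition series_term ::
    "(real ^ 'k \<Rightarrow> complex) \<Rightarrow> (real ^ 'k \<Rightarrow> complex) \<Rightarrow> complex ^ 'k \<Rightarrow> complex \<Rightarrow> int ^ 'k \<Rightarrow> complex"
  where "series_term f g z s n =
    f (lattice_vec n) powr (- s) * g (lattice_vec n) * monom_powi z n"

section \<open>t-summability\<close>

definition supp :: "(int ^ 'k \<Rightarrow> complex) \<Rightarrow> (int ^ 'k) set" where
  "supp c = {m. c m \<noteq> 0}"

text \<open>Both sums below are meaningful only for finitely supported \<open>c\<close>.\<close>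

definition coeff_sum :: "(int ^ 'k \<Rightarrow> complex) \<Rightarrow> complex" where
  "coeff_sum c = (\<Sum>m\<in>supp c. c m)"

definition convolve ::
    "(int ^ 'k \<Rightarrow> complex) \<Rightarrow> (int ^ 'k \<Rightarrow> complex) \<Rightarrow> int ^ 'k \<Rightarrow> complex" where
  "convolve c a n = (\<Sum>m\<in>supp c. c m * a (n - m))"

definition t_summator :: "(int ^ 'k \<Rightarrow> complex) \<Rightarrow> (int ^ 'k \<Rightarrow> complex) \<Rightarrow> bool" where
  "t_summator a c \<longleftrightarrow>
     finite (supp c) \<and> coeff_sum c \<noteq> 0 \<and> (\<lambda>n. norm (convolve c a n)) summable_on UNIV"

definition t_summable :: "(int ^ 'k \<Rightarrow> complex) \<Rightarrow> bool" where
  "t_summable a \<longleftrightarrow> (\<exists>c. t_summator a c)"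

definition t_sums :: "(int ^ 'k \<Rightarrow> complex) \<Rightarrow> complex \<Rightarrow> bool" where
  "t_sums a l \<longleftrightarrow> (\<exists>c. t_summator a c \<and> l = inverse (coeff_sum c) * (\<Sum>\<^sub>\<infinity>n. convolve c a n))"

definition t_sum :: "(int ^ 'k \<Rightarrow> complex) \<Rightarrow> complex" where
  "t_sum a = (THE l. t_sums a l)"

definition extend_zero :: "(int ^ 'k) set \<Rightarrow> (int ^ 'k \<Rightarrow> complex) \<Rightarrow> int ^ 'k \<Rightarrow> complex" where
  "extend_zero A a n = (if n \<in> A then a n else 0)"

text \<open>The sum of a t-summable series does not depend on the choice of \<open>c\<close>.\<close>

lemma convolve_commute: "convolve c (convolve d a) = convolve d (convolve c a)"
proof
  fix n
  have "convolve c (convolve d a) n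
      = (\<Sum>m\<in>supp c. \<Sum>l\<in>supp d. c m * (d l * a (n - m - l)))"
    by (simp add: convolve_def sum_distrib_left)
  also have "\<dots> = (\<Sum>l\<in>supp d. \<Sum>m\<in>supp c. c m * (d l * a (n - m - l)))"
    by (rule sum.swap)
  also have "\<dots> = (\<Sum>l\<in>supp d. \<Sum>m\<in>supp c. d l * (c m * a (n - l - m)))"
    by (intro sum.cong refl) (simp add: algebra_simps)
  also have "\<dots> = convolve d (convolve c a) n"
    by (simp add: convolve_def sum_distrib_left)
  finally show "convolve c (convolve d a) n = convolve d (convolve c a) n" .
qed

lemma has_sum_finite_sum:
  fixes f :: "'i \<Rightarrow> 'a \<Rightarrow> complex"
  assumes "\<And>i. i \<in> I \<Longrightarrow> (f i has_sum s i) A"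
  shows "((\<lambda>x. \<Sum>i\<in>I. f i x) has_sum (\<Sum>i\<in>I. s i)) A"
  using assms by (induction I rule: infinite_finite_induct) (auto intro: has_sum_add)

lemma has_sum_convolve:
  assumes "(b has_sum s) UNIV"
  shows "(convolve c b has_sum (coeff_sum c * s)) UNIV"
proof -
  have "((\<lambda>n. b (n - m)) has_sum s) UNIV" for m
    using assms
    by (subst has_sum_reindex_bij_witness[of UNIV "\<lambda>n. n + m" "\<lambda>n. n - m" UNIV b _ s s]) auto
  then have "((\<lambda>n. \<Sum>m\<in>supp c. c m * b (n - m)) has_sum (\<Sum>m\<in>supp c. c m * s)) UNIV"
    by (intro has_sum_finite_sum has_sum_cmult_right)
  then show ?thesis
    by (simp add: convolve_def[abs_def] coeff_sum_def sum_distrib_right)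
qed

lemma t_sums_unique:
  assumes "t_sums a l" "t_sums a l'"
  shows "l = l'"
proof -
  obtain c d where c: "t_summator a c" and l: "l = inverse (coeff_sum c) * (\<Sum>\<^sub>\<infinity>n. convolve c a n)"
    and d: "t_summator a d" and l': "l' = inverse (coeff_sum d) * (\<Sum>\<^sub>\<infinity>n. convolve d a n)"
    using assms unfolding t_sums_def by blast
  have "(convolve c a has_sum (\<Sum>\<^sub>\<infinity>n. convolve c a n)) UNIV"
       "(convolve d a has_sum (\<Sum>\<^sub>\<infinity>n. convolve d a n)) UNIV"
    using c d unfolding t_summator_def by (blast intro: has_sum_infsum abs_summable_summable)+
  then have "(convolve d (convolve c a) has_sum (coeff_sum d * (\<Sum>\<^sub>\<infinity>n. convolve c a n))) UNIV"
      "(convolve c (convolve d a) has_sum (coeff_sum c * (\<Sum>\<^sub>\<infinity>n. convolve d a n))) UNIV"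
    by (auto intro: has_sum_convolve)
  then have "coeff_sum d * (\<Sum>\<^sub>\<infinity>n. convolve c a n) = coeff_sum c * (\<Sum>\<^sub>\<infinity>n. convolve d a n)"
    unfolding convolve_commute[of c d] by (rule has_sum_unique)
  moreover have "coeff_sum c \<noteq> 0" "coeff_sum d \<noteq> 0"
    using c d by (auto simp: t_summator_def)
  ultimately show ?thesis
    by (simp add: l l' field_simps)
qed

lemma t_sum_eq: "t_sums a l \<Longrightarrow> t_sum a = l"
  unfolding t_sum_def by (blast intro: t_sums_unique)

end

theory Submission
  imports Defs
begin

text \<open>
  Put \<open>F s x = f x powr (- s) * g x\<close>, a function homogeneous of degree \<open>s0 - s\<close>. Since \<open>z\<close> is not
  \<open>(1, ..., 1)\<close>, some coordinate \<open>w = z $ i\<close> differs from \<open>1\<close>. Convolving the series with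
  \<open>c = \<delta>\<^sub>0 - w \<delta>\<^sub>e\<close>, where \<open>e\<close> is the \<open>i\<close>-th basis vector, replaces the term \<open>F s n * z\<^sup>n\<close> by
  \<open>(F s n - F s (n - e)) * z\<^sup>n\<close>: the twist by \<open>w\<close> compensates for the change of the character, and a
  difference of \<open>F s\<close> remains, while the total weight \<open>1 - w\<close> is not zero. The \<open>N\<close>-th convolution
  power of \<open>c\<close> has total weight \<open>(1 - w)\<^sup>N\<close> and produces an \<open>N\<close>-th difference of \<open>F s\<close>
  (\<open>convolve_difference_weights\<close>).

  A difference of order \<open>N\<close> is as small as a derivative of order \<open>N\<close> (\<open>norm_alternating_sum_le\<close>), and
  each derivative lowers the degree of homogeneity by one. Hence the \<open>N\<close>-th difference at \<open>n\<close> is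
  \<open>O(\<bar>n\<bar> powr (Re s0 - Re s - N))\<close>, and the new series converges absolutely once \<open>N\<close> is large.

  For holomorphy in \<open>s\<close> the estimates have to be uniform on discs. That rests on the
  shape of the derivatives: the \<open>N\<close>-th directional derivative of \<open>F s\<close> is \<open>f powr (- s - N)\<close> times a
  polynomial in \<open>s\<close> whose coefficients are smooth and homogeneous of degree \<open>s0\<close>
  (\<open>line_derivative_powr_step\<close>, \<open>iterated_line_derivatives\<close>), so that compactness of the unit sphere
  gives all constants. One \<open>N\<close> and one summable majorant then serve a whole disc
  (\<open>series_term_dominated\<close>), and Weierstrass' theorem applies there (\<open>t_sum_holomorphic\<close>).
\<close>

section \<open>Functions of class \<open>C\<^sup>r\<close>\<close>

lemma Ck_on_cong:
  assumes "open S" "\<And>x. x \<in> S \<Longrightarrow> f x = g x" "Ck_on r f S"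
  shows "Ck_on r g S"
  using assms(2,3)
proof (induction r arbitrary: f g)
  case 0
  then show ?case
    using continuous_on_cong[of S S f g] by simp
next
  case (Suc r)
  have der: "(g has_derivative frechet_derivative f (at x)) (at x)" if "x \<in> S" for x
  proof (rule has_derivative_transform_within_open[OF _ assms(1) that])
    show "(f has_derivative frechet_derivative f (at x)) (at x)"
      using Suc.prems(2) that frechet_derivative_works by auto
  qed (use Suc.prems(1) in auto)
  have "Ck_on r (\<lambda>x. frechet_derivative g (at x) v) S" for v
  proof (rule Suc.IH)
    show "Ck_on r (\<lambda>x. frechet_derivative f (at x) v) S"
      using Suc.prems(2) by simp
  qed (simp add: frechet_derivative_at[OF der, symmetric])
  then show ?case
    using der by (auto simp: differentiable_def)
qed

lemma Ck_on_Suc_imp: "Ck_on (Suc r) f S \<Longrightarrow> Ck_on r f S"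
proof (induction r arbitrary: f)
  case 0
  then show ?case
    by (auto intro!: continuous_at_imp_continuous_on differentiable_imp_continuous_within)
next
  case (Suc r)
  then show ?case
    by (metis Ck_on.simps(2))
qed

lemma Ck_on_add:
  assumes "open S" "Ck_on r f S" "Ck_on r g S"
  shows "Ck_on r (\<lambda>x. f x + g x) S"
  using assms(2,3)
proof (induction r arbitrary: f g)
  case 0
  then show ?case by (auto intro: continuous_on_add)
next
  case (Suc r)
  have der: "((\<lambda>x. f x + g x) has_derivative
      (\<lambda>v. frechet_derivative f (at x) v + frechet_derivative g (at x) v)) (at x)" if "x \<in> S" for x
    using Suc.prems that frechet_derivative_works by (intro has_derivative_add) auto
  have "Ck_on r (\<lambda>x. frechet_derivative (\<lambda>x. f x + g x) (at x) v) S" for v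
  proof (rule Ck_on_cong[OF assms(1)])
    show "Ck_on r (\<lambda>x. frechet_derivative f (at x) v + frechet_derivative g (at x) v) S"
      using Suc by auto
  qed (simp add: frechet_derivative_at[OF der, symmetric])
  then show ?case
    using der by (auto simp: differentiable_def)
qed

lemma Ck_on_mult:
  fixes f g :: "'a::real_normed_vector \<Rightarrow> 'b::real_normed_algebra"
  assumes "open S" "Ck_on r f S" "Ck_on r g S"
  shows "Ck_on r (\<lambda>x. f x * g x) S"
  using assms(2,3)
proof (induction r arbitrary: f g)
  case 0
  then show ?case by (auto intro: continuous_on_mult)
next
  case (Suc r)
  have der: "((\<lambda>x. f x * g x) has_derivative
      (\<lambda>v. f x * frechet_derivative g (at x) v + frechet_derivative f (at x) v * g x)) (at x)"
    if "x \<in> S" for x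
    using Suc.prems that frechet_derivative_works by (intro has_derivative_mult) auto
  have "Ck_on r (\<lambda>x. frechet_derivative (\<lambda>x. f x * g x) (at x) v) S" for v
  proof (rule Ck_on_cong[OF assms(1)])
    show "Ck_on r (\<lambda>x. f x * frechet_derivative g (at x) v + frechet_derivative f (at x) v * g x) S"
      using Suc.prems by (intro Ck_on_add[OF assms(1)] Suc.IH) (auto intro: Ck_on_Suc_imp)
  qed (simp add: frechet_derivative_at[OF der, symmetric])
  then show ?case
    using der by (auto simp: differentiable_def)
qed

section \<open>Smooth homogeneous functions\<close>

text \<open>The degrees make these functions a graded algebra, on which a directional derivative acts with
  degree \<open>-1\<close>.\<close>

definition smooth_homogeneous :: "complex \<Rightarrow> ('a::real_normed_vector \<Rightarrow> complex) \<Rightarrow> bool" where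
  "smooth_homogeneous d g \<longleftrightarrow> smooth_on g (- {0}) \<and>
     (\<forall>t::real. \<forall>x. t > 0 \<longrightarrow> x \<noteq> 0 \<longrightarrow> g (t *\<^sub>R x) = complex_of_real t powr d * g x)"

lemma smooth_homogeneous_mult:
  assumes "smooth_homogeneous d g" "smooth_homogeneous e h"
  shows "smooth_homogeneous (d + e) (\<lambda>x. g x * h x)"
  using assms unfolding smooth_homogeneous_def smooth_on_def
  by (auto intro!: Ck_on_mult simp: powr_add)

lemma smooth_homogeneous_scale:
  assumes "smooth_homogeneous d g"
  shows "smooth_homogeneous d (\<lambda>x. c * g x)"
proof -
  have "Ck_on r (\<lambda>x::'a. c) S" for r S and c :: complex
    by (induction r arbitrary: c) auto
  then show ?thesis
    using assms unfolding smooth_homogeneous_def smooth_on_def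
    by (auto intro!: Ck_on_mult)
qed

lemma smooth_homogeneous_differentiable:
  assumes "smooth_homogeneous d g" "x \<noteq> 0"
  shows "(g has_derivative frechet_derivative g (at x)) (at x)"
proof -
  have "Ck_on (Suc 0) g (- {0})"
    using assms(1) unfolding smooth_homogeneous_def smooth_on_def by blast
  then show ?thesis
    using assms(2) frechet_derivative_works by auto
qed

text \<open>Differentiating \<open>g (t x) = t\<^sup>d g x\<close> with respect to \<open>x\<close> produces one factor \<open>t\<close> on the left, which
  lowers the degree by one.\<close>

lemma smooth_homogeneous_derivative:
  assumes g: "smooth_homogeneous d g"
  shows "smooth_homogeneous (d - 1) (\<lambda>x. frechet_derivative g (at x) v)"
  unfolding smooth_homogeneous_def
proof (intro conjI allI impI)
  show "smooth_on (\<lambda>x. frechet_derivative g (at x) v) (- {0})"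
    using g unfolding smooth_homogeneous_def smooth_on_def by (metis Ck_on.simps(2))
next
  fix t :: real and x :: 'a
  assume t: "t > 0" and x: "x \<noteq> 0"
  define D where "D = (\<lambda>y. frechet_derivative g (at y))"
  have D: "(g has_derivative D y) (at y)" if "y \<noteq> 0" for y
    unfolding D_def by (rule smooth_homogeneous_differentiable[OF g that])
  have "((\<lambda>y. g (t *\<^sub>R y)) has_derivative (\<lambda>v. D (t *\<^sub>R x) (t *\<^sub>R v))) (at x)"
    using t x by (intro has_derivative_compose[OF _ D] derivative_eq_intros) auto
  moreover have "((\<lambda>y. g (t *\<^sub>R y)) has_derivative (\<lambda>v. complex_of_real t powr d * D x v)) (at x)"
  proof (rule has_derivative_transform_within_open)
    show "((\<lambda>y. complex_of_real t powr d * g y) has_derivative (\<lambda>v. complex_of_real t powr d * D x v)) (at x)"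
      by (intro has_derivative_mult_right D x)
    show "open (- {0::'a})" "x \<in> - {0}" using x by auto
  qed (use g t in \<open>auto simp: smooth_homogeneous_def\<close>)
  ultimately have "D (t *\<^sub>R x) (t *\<^sub>R v) = complex_of_real t powr d * D x v"
    using has_derivative_unique by metis
  moreover have "D (t *\<^sub>R x) (t *\<^sub>R v) = t *\<^sub>R D (t *\<^sub>R x) v"
    using t x by (intro linear_scale has_derivative_linear[OF D]) auto
  ultimately show "D (t *\<^sub>R x) v = complex_of_real t powr (d - 1) * D x v"
    using t by (simp add: powr_diff scaleR_conv_of_real field_simps)
qed

text \<open>By homogeneity the size is governed by the values on the unit sphere, which is compact.\<close>

lemma norm_smooth_homogeneous_le:
  fixes g :: "'a::euclidean_space \<Rightarrow> complex"
  assumes g: "smooth_homogeneous d g"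
  obtains C where "C \<ge> 0" "\<And>x. x \<noteq> 0 \<Longrightarrow> norm (g x) \<le> C * norm x powr Re d"
proof -
  have "Ck_on 0 g (- {0})"
    using g unfolding smooth_homogeneous_def smooth_on_def by blast
  then have "continuous_on (sphere 0 1) g"
    by (auto intro: continuous_on_subset)
  then have "bounded (g ` sphere 0 1)"
    by (intro compact_imp_bounded compact_continuous_image) auto
  then obtain C where C: "\<And>u. u \<in> sphere 0 1 \<Longrightarrow> norm (g u) \<le> C"
    unfolding bounded_iff by blast
  have "norm (g x) \<le> \<bar>C\<bar> * norm x powr Re d" if x: "x \<noteq> 0" for x
  proof -
    have "norm x *\<^sub>R (inverse (norm x) *\<^sub>R x) = x" using x by simp
    then have "g x = complex_of_real (norm x) powr d * g (inverse (norm x) *\<^sub>R x)"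
      using g[unfolded smooth_homogeneous_def, THEN conjunct2, rule_format,
        of "norm x" "inverse (norm x) *\<^sub>R x"] x
      by simp
    then have "norm (g x) = norm x powr Re d * norm (g (inverse (norm x) *\<^sub>R x))"
      using x by (simp add: norm_mult norm_powr_real_powr)
    also have "\<dots> \<le> norm x powr Re d * \<bar>C\<bar>"
      using C[of "inverse (norm x) *\<^sub>R x"] x by (intro mult_left_mono) auto
    finally show ?thesis by (simp add: mult.commute)
  qed
  then show ?thesis using that[of "\<bar>C\<bar>"] by auto
qed

section \<open>Directional derivatives of \<open>f\<^sup>-\<^sup>s g\<close>\<close>

text \<open>Derivatives along the lines in the fixed direction \<open>v\<close>, away from the origin. Only functions of one
  real variable get differentiated, so the product and chain rules for vector derivatives apply.\<close>

definition line_derivative :: "'a::real_normed_vector \<Rightarrow> ('a \<Rightarrow> complex) \<Rightarrow> ('a \<Rightarrow> complex) \<Rightarrow> bool" where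
  "line_derivative v F F' \<longleftrightarrow> (\<forall>p t. p + t *\<^sub>R v \<noteq> 0 \<longrightarrow>
     ((\<lambda>t. F (p + t *\<^sub>R v)) has_vector_derivative F' (p + t *\<^sub>R v)) (at t))"

lemma line_derivative_smooth_homogeneous:
  assumes "smooth_homogeneous d g"
  shows "line_derivative v g (\<lambda>x. frechet_derivative g (at x) v)"
  unfolding line_derivative_def
proof (intro allI impI)
  fix p :: 'a and t :: real
  assume nz: "p + t *\<^sub>R v \<noteq> 0"
  have "((\<lambda>t. p + t *\<^sub>R v) has_vector_derivative v) (at t)"
    unfolding has_vector_derivative_def by (intro derivative_eq_intros) auto
  from vector_derivative_diff_chain_within[OF this has_derivative_at_withinI
      [OF smooth_homogeneous_differentiable[OF assms nz]]]
  show "((\<lambda>t. g (p + t *\<^sub>R v)) has_vector_derivative frechet_derivative g (at (p + t *\<^sub>R v)) v) (at t)"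
    by (simp add: o_def)
qed

text \<open>The polynomials in the complex parameter \<open>s\<close> whose coefficients are smooth and homogeneous of degree
  \<open>d\<close>, presented by generators: every property needed of them passes through sums and through
  multiplication by \<open>s\<close>, so no coefficients have to be named.\<close>

inductive parameter_polynomial ::
    "complex \<Rightarrow> (complex \<Rightarrow> 'a::real_normed_vector \<Rightarrow> complex) \<Rightarrow> bool" for d where
  const: "smooth_homogeneous d g \<Longrightarrow> parameter_polynomial d (\<lambda>s. g)"
| add: "parameter_polynomial d G \<Longrightarrow> parameter_polynomial d H \<Longrightarrow>
    parameter_polynomial d (\<lambda>s x. G s x + H s x)"
| parameter: "parameter_polynomial d G \<Longrightarrow> parameter_polynomial d (\<lambda>s x. s * G s x)"

lemma parameter_polynomial_mult:
  assumes "smooth_homogeneous e q" "parameter_polynomial d G"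
  shows "parameter_polynomial (e + d) (\<lambda>s x. q x * G s x)"
  using assms(2)
proof induction
  case (const g)
  then show ?case
    by (intro parameter_polynomial.const smooth_homogeneous_mult assms(1))
next
  case (add G H)
  from parameter_polynomial.add[OF add.IH] show ?case
    by (simp add: distrib_left)
next
  case (parameter G)
  from parameter_polynomial.parameter[OF parameter.IH] show ?case
    by (simp add: mult.left_commute)
qed

lemma parameter_polynomial_scale:
  assumes "parameter_polynomial d G"
  shows "parameter_polynomial d (\<lambda>s x. c * G s x)"
  using assms
proof induction
  case (const g)
  then show ?case
    by (intro parameter_polynomial.const smooth_homogeneous_scale)
next
  case (add G H)
  from parameter_polynomial.add[OF add.IH] show ?case
    by (simp add: distrib_left)
next
  case (parameter G)
  from parameter_polynomial.parameter[OF parameter.IH] show ?case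
    by (simp add: mult.left_commute)
qed

lemma parameter_polynomial_derivative:
  assumes "parameter_polynomial d G"
  shows "\<exists>G'. parameter_polynomial (d - 1) G' \<and> (\<forall>s. line_derivative v (G s) (G' s))"
  using assms
proof induction
  case (const g)
  then show ?case
    using parameter_polynomial.const smooth_homogeneous_derivative line_derivative_smooth_homogeneous
    by blast
next
  case (add G H)
  then obtain G' H' where *: "parameter_polynomial (d - 1) G'" "parameter_polynomial (d - 1) H'"
    "\<forall>s. line_derivative v (G s) (G' s)" "\<forall>s. line_derivative v (H s) (H' s)"
    by blast
  have "line_derivative v (\<lambda>x. G s x + H s x) (\<lambda>x. G' s x + H' s x)" for s
    using *(3,4) unfolding line_derivative_def by (auto intro: has_vector_derivative_add)
  then show ?case
    using parameter_polynomial.add[OF *(1,2)] by blast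
next
  case (parameter G)
  then obtain G' where *: "parameter_polynomial (d - 1) G'" "\<forall>s. line_derivative v (G s) (G' s)"
    by blast
  have "line_derivative v (\<lambda>x. s * G s x) (\<lambda>x. s * G' s x)" for s
    using *(2) unfolding line_derivative_def by (auto intro: has_vector_derivative_mult_right)
  then show ?case
    using parameter_polynomial.parameter[OF *(1)] by blast
qed

lemma norm_parameter_polynomial_le:
  fixes G :: "complex \<Rightarrow> 'a::euclidean_space \<Rightarrow> complex"
  assumes "parameter_polynomial d G"
  shows "\<exists>C\<ge>0. \<forall>s x. norm s \<le> R \<longrightarrow> x \<noteq> 0 \<longrightarrow> norm (G s x) \<le> C * norm x powr Re d"
  using assms
proof induction
  case (const g)
  then show ?case
    using norm_smooth_homogeneous_le by metis
next
  case (add G H)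
  then obtain A B where AB: "A \<ge> 0" "B \<ge> 0"
    "\<And>s x. norm s \<le> R \<Longrightarrow> x \<noteq> 0 \<Longrightarrow> norm (G s x) \<le> A * norm x powr Re d"
    "\<And>s x. norm s \<le> R \<Longrightarrow> x \<noteq> 0 \<Longrightarrow> norm (H s x) \<le> B * norm x powr Re d"
    by blast
  have "norm (G s x + H s x) \<le> (A + B) * norm x powr Re d" if "norm s \<le> R" "x \<noteq> 0" for s x
    using norm_triangle_le[OF add_mono[OF AB(3,4)[OF that]]] by (simp add: distrib_right)
  then show ?case
    using AB(1,2) by (intro exI[of _ "A + B"]) auto
next
  case (parameter G)
  then obtain A where A: "A \<ge> 0"
    "\<And>s x. norm s \<le> R \<Longrightarrow> x \<noteq> 0 \<Longrightarrow> norm (G s x) \<le> A * norm x powr Re d"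
    by blast
  have "norm (s * G s x) \<le> (\<bar>R\<bar> * A) * norm x powr Re d" if "norm s \<le> R" "x \<noteq> 0" for s x
    using mult_mono[of "norm s" "\<bar>R\<bar>", OF _ A(2)[OF that]] that A(1)
    by (simp add: norm_mult mult.assoc)
  then show ?case
    using A(1) by (intro exI[of _ "\<bar>R\<bar> * A"]) auto
qed

text \<open>With \<open>a = - s - N\<close> and \<open>D\<close> the derivative in direction \<open>v\<close>,
  \<open>D (f\<^sup>a G) = f\<^sup>a\<^sup>-\<^sup>1 (a (D f) G + f (D G))\<close>. Taking out the factor \<open>f\<^sup>a\<^sup>-\<^sup>1\<close> avoids dividing by \<open>f\<close>, and
  the cofactor has again degree \<open>d\<close>, because \<open>D f\<close> has degree \<open>0\<close> and \<open>f D\<close> preserves degrees. So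
  each derivative lowers the degree of the whole expression by exactly one, through the power of
  \<open>f\<close>.\<close>

lemma line_derivative_powr_step:
  fixes f :: "'a::real_normed_vector \<Rightarrow> complex"
  assumes f: "smooth_homogeneous 1 f" and pos: "\<And>x. x \<noteq> 0 \<Longrightarrow> f x \<in> \<real> \<and> Re (f x) > 0"
    and G: "parameter_polynomial d G"
  shows "\<exists>H. parameter_polynomial d H \<and>
     (\<forall>s. line_derivative v (\<lambda>x. f x powr (- s - of_nat N) * G s x)
                            (\<lambda>x. f x powr (- s - of_nat (Suc N)) * H s x))"
proof -
  obtain G' where G': "parameter_polynomial (d - 1) G'" "\<And>s. line_derivative v (G s) (G' s)"
    using parameter_polynomial_derivative[OF G] by blast
  define Df where "Df = (\<lambda>x. frechet_derivative f (at x) v)"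
  have Df: "smooth_homogeneous 0 Df" "line_derivative v f Df"
    unfolding Df_def
    using smooth_homogeneous_derivative[OF f] line_derivative_smooth_homogeneous[OF f] by auto
  define P where "P = (\<lambda>s x. Df x * G s x)"
  have P: "parameter_polynomial d P"
    using parameter_polynomial_mult[OF Df(1) G] by (simp add: P_def)
  have Q: "parameter_polynomial d (\<lambda>s x. f x * G' s x)"
    using parameter_polynomial_mult[OF f G'(1)] by simp
  define H where "H = (\<lambda>s x. ((-1) * (s * P s x) + (- of_nat N) * P s x) + f x * G' s x)"
  have H: "parameter_polynomial d H"
    unfolding H_def
    by (intro parameter_polynomial.intros(2,3) parameter_polynomial_scale P Q)
  have "line_derivative v (\<lambda>x. f x powr (- s - of_nat N) * G s x)
                          (\<lambda>x. f x powr (- s - of_nat (Suc N)) * H s x)" for s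
    unfolding line_derivative_def
  proof (intro allI impI)
    fix p :: 'a and t :: real
    let ?x = "p + t *\<^sub>R v"
    assume nz: "?x \<noteq> 0"
    define a where "a = - s - of_nat N"
    have fx: "f ?x \<notin> \<real>\<^sub>\<le>\<^sub>0" "f ?x \<noteq> 0"
      using pos[OF nz] by (auto simp: complex_nonpos_Reals_iff)
    have "((\<lambda>t. f (p + t *\<^sub>R v)) has_vector_derivative Df ?x) (at t)"
      using Df(2) nz unfolding line_derivative_def by blast
    from field_vector_diff_chain_at[OF this has_field_derivative_powr[OF fx(1), of a]]
    have "((\<lambda>t. f (p + t *\<^sub>R v) powr a) has_vector_derivative
        (Df ?x * (a * f ?x powr (a - 1)))) (at t)"
      by (simp add: o_def)
    moreover have "((\<lambda>t. G s (p + t *\<^sub>R v)) has_vector_derivative G' s ?x) (at t)"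
      using G'(2) nz unfolding line_derivative_def by blast
    ultimately have "((\<lambda>t. f (p + t *\<^sub>R v) powr a * G s (p + t *\<^sub>R v)) has_vector_derivative
        (f ?x powr a * G' s ?x + (Df ?x * (a * f ?x powr (a - 1))) * G s ?x)) (at t)"
      by (rule has_vector_derivative_mult)
    moreover have "f ?x powr a = f ?x powr (a - 1) * f ?x"
      using fx(2) by (simp add: powr_diff)
    then have "f ?x powr a * G' s ?x + (Df ?x * (a * f ?x powr (a - 1))) * G s ?x
        = f ?x powr (a - 1) * H s ?x"
      by (simp add: H_def P_def a_def algebra_simps)
    moreover have exponent: "- s - of_nat (Suc N) = a - 1"
      by (simp add: a_def)
    ultimately show "((\<lambda>t. f (p + t *\<^sub>R v) powr (- s - of_nat N) * G s (p + t *\<^sub>R v))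
        has_vector_derivative f ?x powr (- s - of_nat (Suc N)) * H s ?x) (at t)"
      unfolding exponent a_def[symmetric] by (simp only:)
  qed
  with H show ?thesis by blast
qed

text \<open>Here the exponent \<open>a\<close> varies, and the constant has to be locally bounded in it. Since \<open>f\<close> takes
  its values on the unit sphere in a compact subset of the positive half-line, \<open>M\<close> can be taken to
  bound \<open>\<bar>ln f\<bar>\<close> there.\<close>

lemma norm_homogeneous_powr_le:
  fixes f :: "'a::euclidean_space \<Rightarrow> complex"
  assumes f: "smooth_homogeneous 1 f" and pos: "\<And>x. x \<noteq> 0 \<Longrightarrow> f x \<in> \<real> \<and> Re (f x) > 0"
  obtains M where "M \<ge> 0"
    "\<And>x a. x \<noteq> 0 \<Longrightarrow> norm (f x powr a) \<le> exp (M * norm a) * norm x powr Re a"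
proof -
  define u where "u = (\<lambda>x::'a. inverse (norm x) *\<^sub>R x)"
  have "Ck_on 0 f (- {0})"
    using f unfolding smooth_homogeneous_def smooth_on_def by blast
  then have "continuous_on (sphere 0 1) f"
    by (auto intro: continuous_on_subset)
  moreover have "Re (f x) \<noteq> 0" if "x \<in> sphere 0 1" for x
    using pos[of x] that by force
  ultimately have "continuous_on (sphere 0 1) (\<lambda>x. ln (Re (f x)))"
    by (intro continuous_intros) auto
  then have "bounded ((\<lambda>x. ln (Re (f x))) ` sphere 0 1)"
    by (intro compact_imp_bounded compact_continuous_image) auto
  then obtain M where M: "\<And>x. x \<in> sphere 0 1 \<Longrightarrow> \<bar>ln (Re (f x))\<bar> \<le> M"
    unfolding bounded_iff real_norm_def by blast
  have "norm (f x powr a) \<le> exp (\<bar>M\<bar> * norm a) * norm x powr Re a" if x: "x \<noteq> 0" for x a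
  proof -
    have ux: "u x \<in> sphere 0 1" "u x \<noteq> 0" "norm x *\<^sub>R u x = x"
      using x by (auto simp: u_def)
    have "f x = complex_of_real (norm x) powr 1 * f (u x)"
      using f[unfolded smooth_homogeneous_def, THEN conjunct2, rule_format, of "norm x" "u x"] ux(2,3) x
      by simp
    then have fx: "Re (f x) = norm x * Re (f (u x))"
      by simp
    have exponent: "Re a * ln (Re (f (u x))) \<le> \<bar>M\<bar> * norm a"
    proof -
      have "Re a * ln (Re (f (u x))) \<le> \<bar>Re a\<bar> * \<bar>ln (Re (f (u x)))\<bar>"
        by (simp flip: abs_mult)
      also have "\<dots> \<le> norm a * \<bar>M\<bar>"
        using M[OF ux(1)] by (intro mult_mono abs_Re_le_cmod) auto
      finally show ?thesis by (simp add: mult.commute)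
    qed
    have "norm (f x powr a) = Re (f x) powr Re a"
      using pos[OF x] by (simp add: norm_powr_real_powr complex_is_Real_iff cmod_eq_Re)
    also have "\<dots> = norm x powr Re a * Re (f (u x)) powr Re a"
      using pos[OF ux(2)] by (simp add: fx powr_mult)
    also have "Re (f (u x)) powr Re a = exp (Re a * ln (Re (f (u x))))"
      using pos[OF ux(2)] by (auto simp: powr_def)
    also have "norm x powr Re a * \<dots> \<le> norm x powr Re a * exp (\<bar>M\<bar> * norm a)"
      using exponent by (intro mult_left_mono) auto
    finally show ?thesis
      by (simp add: mult.commute)
  qed
  then show ?thesis
    using that[of "\<bar>M\<bar>"] by auto
qed

text \<open>The witness \<open>D j s\<close> is \<open>f powr (- s - j)\<close> times a polynomial in \<open>s\<close> with coefficients of degree \<open>d\<close>.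
  This form is what makes the constant uniform for \<open>s\<close> in a bounded set.\<close>

lemma iterated_line_derivatives:
  fixes f g :: "'a::euclidean_space \<Rightarrow> complex"
  assumes f: "smooth_homogeneous 1 f" and g: "smooth_homogeneous d g"
    and pos: "\<And>x. x \<noteq> 0 \<Longrightarrow> f x \<in> \<real> \<and> Re (f x) > 0"
  obtains D :: "nat \<Rightarrow> complex \<Rightarrow> 'a \<Rightarrow> complex" where
    "\<And>s x. D 0 s x = f x powr (- s) * g x"
    "\<And>j s. line_derivative v (D j s) (D (Suc j) s)"
    "\<And>j R. \<exists>C. \<forall>s x. norm s \<le> R \<longrightarrow> x \<noteq> 0 \<longrightarrow>
       norm (D j s x) \<le> C * norm x powr (Re d - Re s - real j)"
proof -
  have "\<exists>G. \<forall>n. (parameter_polynomial d (G n) \<and> (n = 0 \<longrightarrow> G n = (\<lambda>s. g))) \<and>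
     (\<forall>s. line_derivative v (\<lambda>x. f x powr (- s - of_nat n) * G n s x)
                        (\<lambda>x. f x powr (- s - of_nat (Suc n)) * G (Suc n) s x))"
  proof (rule dependent_nat_choice)
    show "\<exists>G. parameter_polynomial d G \<and> ((0::nat) = 0 \<longrightarrow> G = (\<lambda>s. g))"
      using parameter_polynomial.const[OF g] by blast
  next
    fix G and n :: nat
    assume "parameter_polynomial d G \<and> (n = 0 \<longrightarrow> G = (\<lambda>s. g))"
    then show "\<exists>H. (parameter_polynomial d H \<and> (Suc n = 0 \<longrightarrow> H = (\<lambda>s. g))) \<and>
        (\<forall>s. line_derivative v (\<lambda>x. f x powr (- s - of_nat n) * G s x)
                        (\<lambda>x. f x powr (- s - of_nat (Suc n)) * H s x))"
      using line_derivative_powr_step[OF f pos, of d G v n] by blast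
  qed
  then obtain G where G: "\<And>n. parameter_polynomial d (G n)" "G 0 = (\<lambda>s. g)"
    "\<And>n s. line_derivative v (\<lambda>x. f x powr (- s - of_nat n) * G n s x)
                        (\<lambda>x. f x powr (- s - of_nat (Suc n)) * G (Suc n) s x)"
    by auto
  obtain M where M: "M \<ge> 0"
    "\<And>x a. x \<noteq> 0 \<Longrightarrow> norm (f x powr a) \<le> exp (M * norm a) * norm x powr Re a"
    using norm_homogeneous_powr_le[OF f pos] by blast
  show ?thesis
  proof (rule that[of "\<lambda>n s x. f x powr (- s - of_nat n) * G n s x"])
    fix j :: nat and R :: real
    obtain C where C: "C \<ge> 0"
      "\<And>s x. norm s \<le> R \<Longrightarrow> x \<noteq> 0 \<Longrightarrow> norm (G j s x) \<le> C * norm x powr Re d"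
      using norm_parameter_polynomial_le[OF G(1)] by meson
    have "norm (f x powr (- s - of_nat j) * G j s x)
        \<le> (exp (M * (R + real j)) * C) * norm x powr (Re d - Re s - real j)"
      if s: "norm s \<le> R" and x: "x \<noteq> 0" for s x
    proof -
      have "norm (- s - of_nat j) \<le> R + real j"
        using norm_triangle_ineq4[of "- s" "of_nat j"] s by simp
      then have "exp (M * norm (- s - of_nat j)) \<le> exp (M * (R + real j))"
        using M(1) by (simp add: mult_left_mono)
      then have "norm (f x powr (- s - of_nat j)) \<le> exp (M * (R + real j)) * norm x powr (- Re s - real j)"
        using M(2)[OF x, of "- s - of_nat j"] mult_right_mono[of _ _ "norm x powr (- Re s - real j)"]
        by fastforce
      then have "norm (f x powr (- s - of_nat j) * G j s x)
          \<le> (exp (M * (R + real j)) * norm x powr (- Re s - real j)) * (C * norm x powr Re d)"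
        unfolding norm_mult by (intro mult_mono C(2) s x) auto
      also have "\<dots> = (exp (M * (R + real j)) * C) * (norm x powr (- Re s - real j) * norm x powr Re d)"
        by simp
      also have "norm x powr (- Re s - real j) * norm x powr Re d = norm x powr (Re d - Re s - real j)"
        by (simp flip: powr_add add: algebra_simps)
      finally show ?thesis .
    qed
    then show "\<exists>C. \<forall>s x. norm s \<le> R \<longrightarrow> x \<noteq> 0 \<longrightarrow>
        norm (f x powr (- s - of_nat j) * G j s x) \<le> C * norm x powr (Re d - Re s - real j)"
      by blast
  next
    show "f x powr (- s - of_nat 0) * G 0 s x = f x powr (- s) * g x" for s x
      by (simp add: G(2))
  qed (rule G(3))
qed

section \<open>Finite differences and derivatives\<close>

lemma alternating_sum_Suc:
  fixes \<phi> :: "nat \<Rightarrow> complex"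
  shows "(\<Sum>j\<le>Suc N. (-1) ^ j * of_nat (Suc N choose j) * \<phi> j) =
    (\<Sum>j\<le>N. (-1) ^ j * of_nat (N choose j) * (\<phi> j - \<phi> (Suc j)))"
proof -
  have "(\<Sum>j\<le>Suc N. (-1) ^ j * of_nat (Suc N choose j) * \<phi> j) =
      \<phi> 0 + (\<Sum>j\<le>N. (-1) ^ Suc j * of_nat (Suc N choose Suc j) * \<phi> (Suc j))"
    by (simp only: sum.atMost_Suc_shift) simp
  also have "\<dots> = (\<phi> 0 + (\<Sum>j\<le>N. (-1) ^ Suc j * of_nat (N choose Suc j) * \<phi> (Suc j)))
      - (\<Sum>j\<le>N. (-1) ^ j * of_nat (N choose j) * \<phi> (Suc j))"
  proof -
    have "(\<Sum>j\<le>N. (-1) ^ Suc j * of_nat (Suc N choose Suc j) * \<phi> (Suc j)) =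
        (\<Sum>j\<le>N. (-1) ^ Suc j * of_nat (N choose Suc j) * \<phi> (Suc j)
          - (-1) ^ j * of_nat (N choose j) * \<phi> (Suc j))"
      by (intro sum.cong refl) (simp add: algebra_simps)
    then show ?thesis
      by (simp only: sum_subtractf add_diff_eq)
  qed
  also have "\<phi> 0 + (\<Sum>j\<le>N. (-1) ^ Suc j * of_nat (N choose Suc j) * \<phi> (Suc j)) =
      (\<Sum>j\<le>Suc N. (-1) ^ j * of_nat (N choose j) * \<phi> j)"
    by (simp only: sum.atMost_Suc_shift) simp
  also have "\<dots> = (\<Sum>j\<le>N. (-1) ^ j * of_nat (N choose j) * \<phi> j)"
    by simp
  finally show ?thesis
    by (simp add: right_diff_distrib sum_subtractf)
qed

text \<open>The sum is, up to sign, an \<open>N\<close>-th difference with step \<open>1\<close>. It is controlled by the \<open>N\<close>-th derivative: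
  an \<open>(N + 1)\<close>-st difference of \<open>\<Phi> 0\<close> is an \<open>N\<close>-th difference of \<open>\<Phi> 0 t - \<Phi> 0 (t + 1)\<close>, whose \<open>N\<close>-th
  derivative is, up to sign, a first difference of \<open>\<Phi> N\<close> and is estimated by the mean value inequality.\<close>

lemma norm_alternating_sum_le:
  fixes \<Phi> :: "nat \<Rightarrow> real \<Rightarrow> complex"
  assumes "\<And>j t. j < N \<Longrightarrow> 0 \<le> t \<Longrightarrow> t \<le> real N \<Longrightarrow> (\<Phi> j has_vector_derivative \<Phi> (Suc j) t) (at t)"
    and "\<And>t. 0 \<le> t \<Longrightarrow> t \<le> real N \<Longrightarrow> norm (\<Phi> N t) \<le> B"
  shows "norm (\<Sum>j\<le>N. (-1) ^ j * of_nat (N choose j) * \<Phi> 0 (real j)) \<le> B"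
  using assms
proof (induction N arbitrary: \<Phi>)
  case 0
  then show ?case by simp
next
  case (Suc N)
  define \<Psi> where "\<Psi> = (\<lambda>j t. \<Phi> j t - \<Phi> j (t + 1))"
  have "norm (\<Sum>j\<le>N. (-1) ^ j * of_nat (N choose j) * \<Psi> 0 (real j)) \<le> B"
  proof (rule Suc.IH)
    fix j :: nat and t :: real
    assume j: "j < N" "0 \<le> t" "t \<le> real N"
    have "(\<Phi> j has_vector_derivative \<Phi> (Suc j) (t + 1)) (at (t + 1))"
      using j by (intro Suc.prems) auto
    moreover have "((\<lambda>t::real. t + 1) has_vector_derivative 1) (at t)"
      unfolding has_vector_derivative_def by (intro derivative_eq_intros) auto
    ultimately have "((\<lambda>t. \<Phi> j (t + 1)) has_vector_derivative \<Phi> (Suc j) (t + 1)) (at t)"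
      using vector_diff_chain_at[of "\<lambda>t. t + 1" 1 t "\<Phi> j" "\<Phi> (Suc j) (t + 1)"]
      by (simp add: o_def)
    moreover have "(\<Phi> j has_vector_derivative \<Phi> (Suc j) t) (at t)"
      using j by (intro Suc.prems) auto
    ultimately show "(\<Psi> j has_vector_derivative \<Psi> (Suc j) t) (at t)"
      unfolding \<Psi>_def by (intro has_vector_derivative_diff)
  next
    fix t :: real
    assume t: "0 \<le> t" "t \<le> real N"
    have der: "(\<Phi> N has_vector_derivative \<Phi> (Suc N) u) (at u)" if "t \<le> u" "u \<le> t + 1" for u
      using that t by (intro Suc.prems) auto
    have "\<exists>u\<in>{t<..<t + 1}. norm (\<Phi> N (t + 1) - \<Phi> N t) \<le> norm ((t + 1 - t) *\<^sub>R \<Phi> (Suc N) u)"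
    proof (rule mvt_general)
      show "continuous_on {t..t + 1} (\<Phi> N)"
        using der by (intro continuous_at_imp_continuous_on ballI has_vector_derivative_continuous) auto
      show "(\<Phi> N has_derivative (\<lambda>h. h *\<^sub>R \<Phi> (Suc N) u)) (at u)" if "t < u" "u < t + 1" for u
        using der[of u] that by (simp add: has_vector_derivative_def)
    qed auto
    then obtain u where "u \<in> {t<..<t + 1}" "norm (\<Phi> N (t + 1) - \<Phi> N t) \<le> norm (\<Phi> (Suc N) u)"
      by auto
    moreover from this have "norm (\<Phi> (Suc N) u) \<le> B"
      using t by (intro Suc.prems) auto
    ultimately show "norm (\<Psi> N t) \<le> B"
      by (simp add: \<Psi>_def norm_minus_commute)
  qed
  then show ?case
    unfolding alternating_sum_Suc[of N "\<lambda>j. \<Phi> 0 (real j)"] by (simp add: \<Psi>_def add.commute)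
qed

section \<open>Summation over the lattice\<close>

lemma summable_inverse_square_int: "(\<lambda>m::int. inverse ((1 + \<bar>real_of_int m\<bar>) ^ 2)) summable_on UNIV"
proof -
  let ?h = "\<lambda>m::int. inverse ((1 + \<bar>real_of_int m\<bar>) ^ 2)"
  have "summable (\<lambda>n. inverse (real n ^ 2))"
    by (rule inverse_power_summable) simp
  then have "summable (\<lambda>n. inverse (real (Suc n) ^ 2))"
    by (subst summable_Suc_iff)
  then have "(\<lambda>n. inverse ((1 + real n) ^ 2)) summable_on UNIV"
    by (subst summable_on_UNIV_nonneg_real_iff) auto
  then have "?h summable_on range int" "?h summable_on range (\<lambda>n. - int n)"
    by (subst summable_on_reindex; simp add: inj_on_def o_def)+
  then have "?h summable_on (range int \<union> range (\<lambda>n. - int n))"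
    by (rule summable_on_union)
  moreover have "range int \<union> range (\<lambda>n. - int n) = UNIV"
    by (auto intro: int_cases2)
  ultimately show ?thesis by simp
qed

lemma summable_prod_coordinates:
  fixes h :: "int \<Rightarrow> real"
  assumes "h summable_on UNIV"
  shows "(\<lambda>n::int ^ 'k. \<Prod>i\<in>UNIV. h (n $ i)) summable_on UNIV"
proof -
  have "Infinite_Set_Sum.abs_summable_on h UNIV"
    using assms by (metis abs_summable_equivalent summable_on_iff_abs_summable_on_real)
  then have "Infinite_Set_Sum.abs_summable_on (\<lambda>\<nu>::'k \<Rightarrow> int. \<Prod>i\<in>UNIV. h (\<nu> i)) (PiE UNIV (\<lambda>_. UNIV))"
    by (intro abs_summable_on_prod_PiE) auto
  then have "(\<lambda>\<nu>::'k \<Rightarrow> int. \<Prod>i\<in>UNIV. h (\<nu> i)) summable_on UNIV"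
    unfolding abs_summable_equivalent[symmetric] PiE_UNIV_domain
    using abs_summable_summable by fastforce
  moreover have "bij_betw (vec_nth :: int ^ 'k \<Rightarrow> _) UNIV UNIV"
    by (intro bij_betwI[of _ _ _ vec_lambda]) (auto simp: vec_eq_iff)
  ultimately show ?thesis
    using summable_on_reindex_bij_betw[of vec_nth "UNIV :: (int ^ 'k) set" UNIV "\<lambda>\<nu>. \<Prod>i\<in>UNIV. h (\<nu> i)"]
    by simp
qed

text \<open>The exponent is twice the dimension, rather than anything larger than the dimension, because then
  the term is dominated by a product over the coordinates of inverse squares, which is summable by
  Fubini.\<close>

lemma summable_lattice_decay:
  "(\<lambda>n::int ^ 'k. (1 + norm (lattice_vec n)) powr (- 2 * real CARD('k))) summable_on UNIV"
proof (rule summable_on_comparison_test)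
  show "(\<lambda>n::int ^ 'k. \<Prod>i\<in>UNIV. inverse ((1 + \<bar>real_of_int (n $ i)\<bar>) ^ 2)) summable_on UNIV"
    by (rule summable_prod_coordinates[OF summable_inverse_square_int])
next
  fix n :: "int ^ 'k"
  let ?r = "1 + norm (lattice_vec n)"
  have "?r powr (- 2 * real CARD('k)) = (\<Prod>i\<in>(UNIV::'k set). inverse (?r ^ 2))"
  proof -
    have "?r > 0" by (simp add: add_pos_nonneg)
    then have "?r powr (- 2 * real CARD('k)) = inverse (?r ^ (2 * CARD('k)))"
      by (simp add: powr_minus flip: powr_realpow)
    then show ?thesis
      by (simp add: power_mult power_inverse)
  qed
  also have "\<dots> \<le> (\<Prod>i\<in>UNIV. inverse ((1 + \<bar>real_of_int (n $ i)\<bar>) ^ 2))"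
  proof (intro prod_mono conjI le_imp_inverse_le power_mono add_left_mono)
    show "\<bar>real_of_int (n $ i)\<bar> \<le> norm (lattice_vec n)" for i
      using component_le_norm_cart[of "lattice_vec n" i] by (simp add: lattice_vec_def)
  qed auto
  finally show "?r powr (- 2 * real CARD('k)) \<le> (\<Prod>i\<in>UNIV. inverse ((1 + \<bar>real_of_int (n $ i)\<bar>) ^ 2))" .
qed auto

lemma finite_lattice_ball: "finite {n::int ^ 'k. norm (lattice_vec n) \<le> r}"
proof (rule finite_subset)
  let ?P = "PiE (UNIV::'k set) (\<lambda>_. {- \<lceil>r\<rceil>..\<lceil>r\<rceil>})"
  show "finite (vec_lambda ` ?P)"
    by (intro finite_imageI finite_PiE) auto
  show "{n::int ^ 'k. norm (lattice_vec n) \<le> r} \<subseteq> vec_lambda ` ?P"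
  proof
    fix n :: "int ^ 'k"
    assume n: "n \<in> {n. norm (lattice_vec n) \<le> r}"
    have "n $ i \<in> {- \<lceil>r\<rceil>..\<lceil>r\<rceil>}" for i
    proof -
      have "\<bar>real_of_int (n $ i)\<bar> \<le> r"
        using component_le_norm_cart[of "lattice_vec n" i] n by (simp add: lattice_vec_def)
      then show ?thesis by (simp add: abs_le_iff) linarith
    qed
    then have "vec_nth n \<in> ?P" by auto
    then show "n \<in> vec_lambda ` ?P"
      by (metis image_eqI vec_nth_inverse)
  qed
qed

section \<open>Holomorphy of a t-sum\<close>

text \<open>On each disc about \<open>0\<close> one \<open>c\<close> serves all parameters, and there the t-sum is a uniformly convergent
  series of holomorphic functions. The weights \<open>c\<close> may change with the disc, because the t-sum does
  not depend on them.\<close>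

lemma t_sum_holomorphic:
  fixes a :: "complex \<Rightarrow> int ^ 'k \<Rightarrow> complex"
  assumes holo: "\<And>n. (\<lambda>s. a s n) holomorphic_on UNIV"
    and dominated: "\<And>R. \<exists>c M. finite (supp c) \<and> coeff_sum c \<noteq> 0 \<and> M summable_on UNIV \<and>
      (\<forall>s n. norm s \<le> R \<longrightarrow> norm (convolve c (a s) n) \<le> M n)"
  shows "(\<forall>s. t_summable (a s)) \<and> (\<lambda>s. t_sum (a s)) holomorphic_on UNIV"
proof -
  have local: "(\<forall>s\<in>cball 0 R. t_summable (a s)) \<and> (\<lambda>s. t_sum (a s)) holomorphic_on ball 0 R" for R
  proof -
    obtain c M where c: "finite (supp c)" "coeff_sum c \<noteq> 0" and M: "M summable_on UNIV"
      and le: "\<And>s n. norm s \<le> R \<Longrightarrow> norm (convolve c (a s) n) \<le> M n"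
      using dominated by blast
    have summator: "t_summator (a s) c" if "s \<in> cball 0 R" for s
      unfolding t_summator_def
      using c that le by (auto intro!: Infinite_Sum.abs_summable_on_comparison_test'[OF M])
    have t_sum: "t_sum (a s) = inverse (coeff_sum c) * (\<Sum>\<^sub>\<infinity>n. convolve c (a s) n)"
      if "s \<in> cball 0 R" for s
      using summator[OF that] by (intro t_sum_eq) (auto simp: t_sums_def)
    have holo_term: "(\<lambda>s. convolve c (a s) n) holomorphic_on A" for n A
      unfolding convolve_def using holo
      by (intro holomorphic_on_sum holomorphic_on_mult holomorphic_on_const)
         (blast intro: holomorphic_on_subset)
    have "(\<lambda>s. \<Sum>\<^sub>\<infinity>n. convolve c (a s) n) holomorphic_on ball 0 R"
    proof (rule holomorphic_uniform_limit)
      show "uniform_limit (cball 0 R) (\<lambda>X s. \<Sum>n\<in>X. convolve c (a s) n)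
          (\<lambda>s. \<Sum>\<^sub>\<infinity>n. convolve c (a s) n) (finite_subsets_at_top UNIV)"
        using le by (intro Weierstrass_m_test_general[OF _ M]) auto
      show "\<forall>\<^sub>F X in finite_subsets_at_top UNIV.
          continuous_on (cball 0 R) (\<lambda>s. \<Sum>n\<in>X. convolve c (a s) n) \<and>
          (\<lambda>s. \<Sum>n\<in>X. convolve c (a s) n) holomorphic_on ball 0 R"
        using holo_term
        by (intro always_eventually allI conjI holomorphic_on_imp_continuous_on holomorphic_on_sum)
    qed auto
    then have "(\<lambda>s. inverse (coeff_sum c) * (\<Sum>\<^sub>\<infinity>n. convolve c (a s) n)) holomorphic_on ball 0 R"
      by (intro holomorphic_intros)
    then have "(\<lambda>s. t_sum (a s)) holomorphic_on ball 0 R"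
      using t_sum by (subst holomorphic_cong[OF refl]) auto
    moreover have "\<forall>s\<in>cball 0 R. t_summable (a s)"
      using summator unfolding t_summable_def by blast
    ultimately show ?thesis by blast
  qed
  have "t_summable (a s)" for s
    using local[of "norm s"] by simp
  moreover have "(\<lambda>s. t_sum (a s)) holomorphic_on (\<Union>R. ball 0 R)"
    using local by (intro holomorphic_on_UN_open) auto
  moreover have "(\<Union>R. ball (0::complex) R) = UNIV"
    using lt_ex gt_ex by (auto simp: dist_norm)
  ultimately show ?thesis by simp
qed

section \<open>Difference operators twisted by a character\<close>

text \<open>The \<open>N\<close>-fold convolution power of \<open>\<delta>\<^sub>0 - w \<delta>\<^sub>e\<close> with \<open>e = axis i 1\<close>, expanded by the binomial
  theorem.\<close>

definition difference_weights :: "'k \<Rightarrow> complex \<Rightarrow> nat \<Rightarrow> int ^ 'k \<Rightarrow> complex" where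
  "difference_weights i w N m =
    (if m \<in> (\<lambda>j. axis i (int j)) ` {..N} then of_nat (N choose nat (m $ i)) * (- w) ^ nat (m $ i) else 0)"

lemma supp_difference_weights:
  assumes "w \<noteq> 0"
  shows "supp (difference_weights i w N) = (\<lambda>j. axis i (int j)) ` {..N}"
  using assms by (auto simp: supp_def difference_weights_def axis_def)

lemma sum_difference_weights:
  assumes "w \<noteq> 0"
  shows "(\<Sum>m\<in>supp (difference_weights i w N). difference_weights i w N m * \<phi> m) =
    (\<Sum>j\<le>N. of_nat (N choose j) * (- w) ^ j * \<phi> (axis i (int j)))"
proof -
  have "inj_on (\<lambda>j. axis i (int j)) {..N}"
    by (auto simp: inj_on_def axis_eq_axis)
  then show ?thesis
    unfolding supp_difference_weights[OF assms]
    by (subst sum.reindex) (auto simp: difference_weights_def axis_def intro!: sum.cong)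
qed

lemma coeff_sum_difference_weights:
  assumes "w \<noteq> 0"
  shows "coeff_sum (difference_weights i w N) = (1 - w) ^ N"
  using sum_difference_weights[OF assms, of i N "\<lambda>_. 1"] binomial_ring[of "- w" 1 N]
  by (simp add: coeff_sum_def)

lemma monom_powi_diff_axis:
  fixes z :: "complex ^ 'k"
  assumes "\<And>i. z $ i \<noteq> 0"
  shows "monom_powi z (n - axis i (int j)) = monom_powi z n / (z $ i) ^ j"
proof -
  have "monom_powi z (n - axis i (int j)) = monom_powi z n / monom_powi z (axis i (int j))"
    using assms by (simp add: monom_powi_def power_int_diff prod_dividef)
  also have "monom_powi z (axis i (int j)) = (\<Prod>l\<in>UNIV. if l = i then (z $ i) ^ j else 1)"
    unfolding monom_powi_def by (intro prod.cong) (auto simp: axis_def)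
  finally show ?thesis by simp
qed

text \<open>With \<open>w = z $ i\<close> the twist cancels the variation of the character along the \<open>i\<close>-th axis, so that a
  plain difference of the remaining factor is left over.\<close>

lemma convolve_difference_weights:
  fixes z :: "complex ^ 'k"
  assumes z: "\<And>i. z $ i \<noteq> 0"
    and a: "\<And>j. j \<le> N \<Longrightarrow> a (n - axis i (int j)) = F j * monom_powi z (n - axis i (int j))"
  shows "convolve (difference_weights i (z $ i) N) a n =
    monom_powi z n * (\<Sum>j\<le>N. (-1) ^ j * of_nat (N choose j) * F j)"
proof -
  have "convolve (difference_weights i (z $ i) N) a n =
      (\<Sum>j\<le>N. of_nat (N choose j) * (- (z $ i)) ^ j * a (n - axis i (int j)))"
    unfolding convolve_def by (rule sum_difference_weights[OF z])
  also have "\<dots> = (\<Sum>j\<le>N. monom_powi z n * ((-1) ^ j * of_nat (N choose j) * F j))"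
    using z by (intro sum.cong refl)
      (simp add: a monom_powi_diff_axis[OF z] power_minus[of "z $ i"])
  finally show ?thesis by (simp add: sum_distrib_left)
qed

lemma norm_monom_powi:
  fixes z :: "complex ^ 'k"
  assumes "\<And>i. norm (z $ i) = 1"
  shows "norm (monom_powi z n) = 1"
  using assms by (simp add: monom_powi_def norm_power_int flip: prod_norm)

section \<open>The twisted series\<close>

lemma holomorphic_series_term:
  assumes "\<And>x. x \<noteq> 0 \<Longrightarrow> f x \<noteq> 0"
  shows "(\<lambda>s. extend_zero (- {0}) (series_term f g z s) n) holomorphic_on A"
proof (cases "n = 0")
  case False
  then have "f (lattice_vec n) \<noteq> 0"
    by (intro assms) (auto simp: lattice_vec_def vec_eq_iff)
  then show ?thesis
    using False by (simp add: extend_zero_def series_term_def powr_def) (intro holomorphic_intros)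
qed (simp add: extend_zero_def)

text \<open>The order \<open>N\<close> of the difference depends on \<open>R\<close>: after \<open>N\<close> derivatives the degree of homogeneity is
  \<open>s0 - s - N\<close>, and its real part must be at most minus twice the dimension whenever \<open>norm s \<le> R\<close>. The
  segment of length \<open>N\<close> on which the \<open>N\<close>-th difference at \<open>n\<close> lives must stay away from the origin; this
  fails for only finitely many \<open>n\<close>, and for these the continuity of the term in \<open>s\<close> is enough.\<close>

lemma series_term_dominated:
  fixes f g :: "real ^ 'k \<Rightarrow> complex"
  assumes f: "smooth_homogeneous 1 f" and g: "smooth_homogeneous s0 g"
    and pos: "\<And>x. x \<noteq> 0 \<Longrightarrow> f x \<in> \<real> \<and> Re (f x) > 0"
    and z: "\<And>i. norm ((z :: complex ^ 'k) $ i) = 1"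
  shows "\<exists>N M. M summable_on UNIV \<and> (\<forall>s n. norm s \<le> R \<longrightarrow>
    norm (convolve (difference_weights i (z $ i) N) (extend_zero (- {0}) (series_term f g z s)) n) \<le> M n)"
proof -
  define k where "k = 2 * real CARD('k)"
  have "k > 0" by (simp add: k_def)
  \<comment> \<open>The summand \<open>1\<close> makes \<open>N\<close> positive, so that \<open>2 * N < norm x\<close> keeps the points
    of the segment outside the open unit ball, where powers grow with their exponents.\<close>
  define N where "N = nat \<lceil>1 + \<bar>R\<bar> + \<bar>Re s0\<bar> + k\<rceil>"
  have N: "real N \<ge> 1 + \<bar>R\<bar> + \<bar>Re s0\<bar> + k"
    unfolding N_def by linarith
  have z0: "z $ i \<noteq> 0" for i
    using z[of i] by auto
  define T where "T = (\<lambda>s n. convolve (difference_weights i (z $ i) N)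
    (extend_zero (- {0}) (series_term f g z s)) n)"
  \<comment> \<open>The convolution evaluates at \<open>n - axis i j\<close>, hence the sign of the direction.\<close>
  define v :: "real ^ 'k" where "v = - axis i 1"
  obtain D where D: "\<And>s x. D 0 s x = f x powr (- s) * g x"
    "\<And>j s. line_derivative v (D j s) (D (Suc j) s)"
    "\<And>j R. \<exists>C. \<forall>s x. norm s \<le> R \<longrightarrow> x \<noteq> 0 \<longrightarrow>
       norm (D j s x) \<le> C * norm x powr (Re s0 - Re s - real j)"
    using iterated_line_derivatives[OF f g pos] by blast
  obtain C where C: "\<And>s x. norm s \<le> R \<Longrightarrow> x \<noteq> 0 \<Longrightarrow>
      norm (D N s x) \<le> C * norm x powr (Re s0 - Re s - real N)"
    using D(3)[of R N] by blast
  define K where "K = \<bar>C\<bar> * 4 powr k"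

  have far: "norm (T s n) \<le> K * (1 + norm (lattice_vec n)) powr (- k)"
    if s: "norm s \<le> R" and n: "norm (lattice_vec n) > 2 * real N" for s n
  proof -
    let ?x = "lattice_vec n"
    have away: "norm (?x + t *\<^sub>R v) \<ge> 1" "norm (?x + t *\<^sub>R v) \<ge> (1 + norm ?x) / 4"
      if t: "0 \<le> t" "t \<le> real N" for t
    proof -
      have "norm (?x + t *\<^sub>R v) \<ge> norm ?x - real N"
        using norm_diff_ineq[of ?x "t *\<^sub>R v"] t by (simp add: v_def)
      then show "norm (?x + t *\<^sub>R v) \<ge> 1" "norm (?x + t *\<^sub>R v) \<ge> (1 + norm ?x) / 4"
        using n N \<open>k > 0\<close> by argo+
    qed
    then have nonzero: "?x + t *\<^sub>R v \<noteq> 0" if "0 \<le> t" "t \<le> real N" for t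
      using that by fastforce
    have bound: "norm (D N s (?x + t *\<^sub>R v)) \<le> K * (1 + norm ?x) powr (- k)"
      if t: "0 \<le> t" "t \<le> real N" for t
    proof -
      let ?y = "?x + t *\<^sub>R v"
      have "- Re s \<le> R"
        using abs_Re_le_cmod[of s] s by linarith
      then have "norm ?y powr (Re s0 - Re s - real N) \<le> norm ?y powr (- k)"
        using away(1)[OF t] N by (intro powr_mono) linarith+
      also have "\<dots> \<le> ((1 + norm ?x) / 4) powr (- k)"
        using away(2)[OF t] \<open>k > 0\<close> by (intro powr_mono2') (auto simp: add_pos_nonneg)
      also have "\<dots> = 4 powr k * (1 + norm ?x) powr (- k)"
        by (simp add: powr_divide powr_minus field_simps)
      finally have "\<bar>C\<bar> * norm ?y powr (Re s0 - Re s - real N) \<le> K * (1 + norm ?x) powr (- k)"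
        unfolding K_def mult.assoc by (intro mult_left_mono) auto
      moreover have "C * norm ?y powr (Re s0 - Re s - real N) \<le> \<bar>C\<bar> * norm ?y powr (Re s0 - Re s - real N)"
        by (intro mult_right_mono) auto
      ultimately show ?thesis
        using C[OF s nonzero[OF t]] by linarith
    qed
    have "norm (\<Sum>j\<le>N. (-1) ^ j * of_nat (N choose j) * D 0 s (?x + real j *\<^sub>R v))
        \<le> K * (1 + norm ?x) powr (- k)"
    proof (rule norm_alternating_sum_le[where \<Phi> = "\<lambda>j t. D j s (?x + t *\<^sub>R v)"])
      show "((\<lambda>t. D j s (?x + t *\<^sub>R v)) has_vector_derivative D (Suc j) s (?x + t *\<^sub>R v)) (at t)"
        if "0 \<le> t" "t \<le> real N" for j t
        using D(2) nonzero[OF that] unfolding line_derivative_def by blast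
    qed (rule bound)
    moreover have "T s n = monom_powi z n *
        (\<Sum>j\<le>N. (-1) ^ j * of_nat (N choose j) * D 0 s (?x + real j *\<^sub>R v))"
      unfolding T_def
    proof (rule convolve_difference_weights[OF z0])
      fix j
      assume j: "j \<le> N"
      have shift: "lattice_vec (n - axis i (int j)) = ?x + real j *\<^sub>R v"
        by (auto simp: lattice_vec_def vec_eq_iff v_def axis_def)
      then have "lattice_vec (n - axis i (int j)) \<noteq> 0"
        using nonzero[of "real j"] j by simp
      then have "n - axis i (int j) \<noteq> 0"
        by (auto simp: lattice_vec_def vec_eq_iff)
      then show "extend_zero (- {0}) (series_term f g z s) (n - axis i (int j)) =
          D 0 s (?x + real j *\<^sub>R v) * monom_powi z (n - axis i (int j))"
        by (simp add: extend_zero_def series_term_def D(1) shift)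
    qed
    ultimately show ?thesis
      by (simp add: norm_mult norm_monom_powi[OF z])
  qed

  have "\<exists>B. \<forall>s. norm s \<le> R \<longrightarrow> norm (T s n) \<le> B" for n
  proof -
    have "f x \<noteq> 0" if "x \<noteq> 0" for x
      using pos[OF that] by auto
    then have "(\<lambda>s. T s n) holomorphic_on cball 0 R"
      unfolding T_def convolve_def
      by (intro holomorphic_on_sum holomorphic_on_mult holomorphic_on_const holomorphic_series_term)
    then have "bounded ((\<lambda>s. T s n) ` cball 0 R)"
      by (intro compact_imp_bounded compact_continuous_image holomorphic_on_imp_continuous_on) auto
    then obtain B where "\<forall>s\<in>cball 0 R. norm (T s n) \<le> B"
      by (auto simp: bounded_iff)
    then show ?thesis
      by (intro exI[of _ B]) auto
  qed
  then obtain B where near: "\<And>s n. norm s \<le> R \<Longrightarrow> norm (T s n) \<le> B n"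
    by metis

  define S :: "(int ^ 'k) set" where "S = {n. norm (lattice_vec n) \<le> 2 * real N}"
  define M where "M = (\<lambda>n. if n \<in> S then B n else K * (1 + norm (lattice_vec n)) powr (- k))"
  have "M summable_on S"
    unfolding S_def by (intro summable_on_finite finite_lattice_ball)
  moreover have "M summable_on (- S)"
  proof (rule summable_on_cong[THEN iffD1])
    show "(\<lambda>n. K * (1 + norm (lattice_vec n)) powr (- k)) summable_on (- S)"
      using summable_lattice_decay unfolding k_def minus_mult_left
      by (intro summable_on_cmult_right) (rule summable_on_subset_banach, auto)
  qed (simp add: M_def)
  ultimately have "M summable_on (S \<union> - S)"
    by (rule summable_on_union)
  then have "M summable_on UNIV" by simp
  moreover have "norm (T s n) \<le> M n" if "norm s \<le> R" for s n
    using far[OF that, of n] near[OF that, of n] by (auto simp: M_def S_def)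
  ultimately show ?thesis
    unfolding T_def by blast
qed

theorem corollary3p10:
  fixes f g :: "real ^ 'k \<Rightarrow> complex"
    and s0 :: complex and \<epsilon> :: int
    and z :: "complex ^ 'k"
  assumes "\<epsilon> \<in> {1, -1}"
    and "smooth_on f (- {0})" and "smooth_on g (- {0})"
    and "homogeneous 1 1 f" and "homogeneous s0 \<epsilon> g"
    and "\<And>x. x \<noteq> 0 \<Longrightarrow> f x \<in> \<real> \<and> Re (f x) > 0"
    and "\<And>i. norm (z $ i) = 1"
    and "z \<noteq> (\<chi> i. 1)"
  shows "(\<forall>s. t_summable (extend_zero (- {0}) (series_term f g z s)))
       \<and> (\<lambda>s. t_sum (extend_zero (- {0}) (series_term f g z s))) holomorphic_on UNIV"
proof (rule t_sum_holomorphic)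
  have "f x \<noteq> 0" if "x \<noteq> 0" for x
    using assms(6)[OF that] by auto
  then show "(\<lambda>s. extend_zero (- {0}) (series_term f g z s) n) holomorphic_on UNIV" for n
    by (rule holomorphic_series_term)
next
  fix R :: real
  obtain i where i: "z $ i \<noteq> 1"
    using assms(8) by (auto simp: vec_eq_iff)
  have zi: "z $ i \<noteq> 0"
    using assms(7)[of i] by auto
  have f: "smooth_homogeneous 1 f" and g: "smooth_homogeneous s0 g"
    using assms(2-5) unfolding smooth_homogeneous_def homogeneous_def by blast+
  obtain N M where "M summable_on UNIV" "\<And>s n. norm s \<le> R \<Longrightarrow>
      norm (convolve (difference_weights i (z $ i) N) (extend_zero (- {0}) (series_term f g z s)) n) \<le> M n"
    using series_term_dominated[OF f g assms(6,7), of R i] by blast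
  moreover have "finite (supp (difference_weights i (z $ i) N))"
    by (simp add: supp_difference_weights[OF zi])
  moreover have "coeff_sum (difference_weights i (z $ i) N) \<noteq> 0"
    using i by (simp add: coeff_sum_difference_weights[OF zi])
  ultimately show "\<exists>c M. finite (supp c) \<and> coeff_sum c \<noteq> 0 \<and> M summable_on UNIV \<and>
      (\<forall>s n. norm s \<le> R \<longrightarrow>
        norm (convolve c (extend_zero (- {0}) (series_term f g z s)) n) \<le> M n)"
    by blast
qed

end
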